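(* Let $X$ be a topological space and let $(X,\Sigma,\mu)$ be a measure space such that every open subset of $X$ belongs to $\Sigma$. Suppose that $\mu$ is finite (with $\mu(X)>0$) and nonatomic, and that every measurable set is approximable by open sets. Then for any open set $A$ with $\mu(A)<\infty$ there exists an O-segment $u(t)$, $t\in[0,1]$, for $\mu$ such that $u(\mu(A)/\mu(X))=A$.
   Context: Measures are nonnegative. A measure space $(X,\Sigma,\mu)$ is nonatomic if for every $A\in\Sigma$ with $\mu(A)>0$ there exists $B\in\Sigma$, $B\subset A$, with $0<\mu(B)<\mu(A)$. A measurable set $A$ is approximable by open sets if for every $\epsilon>0$ there exists an open set $O$ such that $\mu(A\oplus O)<\epsilon$, where $\oplus$ denotes symmetric difference. An O-segment for a finite measure $\mu$ is a family of open sets $u(t)\subset X$, $t\in[0,1]$, such that $u(0)=\emptyset$, $u(1)=X$, $u(s)\subset u(t)$ if $s<t$, and $\mu(u(t))=t\,\mu(X)$ for all $t\in[0,1]$. Here $\subset$ allows equality.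
   Formalization: The formal theorem also assumes that A is empty if μ(A)=0 and A=X if μ(A)=μ(X); without this the claim fails, since u(0)=∅ and u(1)=X (e.g. A=(0,1) in X=[0,1] with Lebesgue measure). *)

theory Defs
  imports "HOL-Analysis.Analysis"
begin

definition nonatomic :: "'a measure \<Rightarrow> bool" where
  "nonatomic M \<longleftrightarrow>
     (\<forall>A\<in>sets M. emeasure M A > 0 \<longrightarrow>
        (\<exists>B\<in>sets M. B \<subseteq> A \<and> 0 < emeasure M B \<and> emeasure M B < emeasure M A))"

definition approximable_by_open :: "'a topology \<Rightarrow> 'a measure \<Rightarrow> 'a set \<Rightarrow> bool" where
  "approximable_by_open X M A \<longleftrightarrow>
     (\<forall>\<epsilon>::real. \<epsilon> > 0 \<longrightarrow> (\<exists>U. openin X U \<and> emeasure M (sym_diff A U) < ennreal \<epsilon>))"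

(* Intended for finite measures for which all open sets are measurable; the
   real-valued measure is 0 on sets that are not measurable or have infinite measure.
   Only the values u t with 0 \<le> t \<le> 1 are relevant. *)
definition O_segment :: "'a topology \<Rightarrow> 'a measure \<Rightarrow> (real \<Rightarrow> 'a set) \<Rightarrow> bool" where
  "O_segment X M u \<longleftrightarrow>
     (\<forall>t\<in>{0..1}. openin X (u t)) \<and>
     u 0 = {} \<and> u 1 = topspace X \<and>
     (\<forall>s\<in>{0..1}. \<forall>t\<in>{0..1}. s < t \<longrightarrow> u s \<subseteq> u t) \<and>
     (\<forall>t\<in>{0..1}. measure M (u t) = t * measure M (topspace X))"

(* A segment takes the values {} at 0 and the whole space at 1. So no segment can pass
   at time measure M A / measure M (space M) through a nonempty open null set A, nor
   through an open set A of full measure that is not the whole space: take Lebesgue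
   measure on [0,1] with its usual topology and A = (0,1). A theorem on segments through
   a given open set A must therefore exclude these two cases. *)

end

theory Submission
  imports Defs
begin

text \<open>
  For open sets \<open>G \<subseteq> H\<close> every value \<open>c\<close> between their measures is taken by an open set in
  between. Among the open sets between \<open>G\<close> and \<open>H\<close> of measure at most \<open>c\<close>, take a greedy increasing
  sequence; its union \<open>V\<close> cannot be enlarged to one of larger measure. If \<open>V\<close> had measure below
  \<open>c\<close>, an open approximation of a small nonnull subset of \<open>H - V\<close> would enlarge it.

  Starting with the chain \<open>{}, A, space M\<close>, one inserts successively open sets whose measures are the
  rational numbers in the range. The resulting countable chain has a dense set of measures,
  and the union of its members of measure less than \<open>s\<close> is open and has measure \<open>s\<close>.
\<close>

section \<open>Nonnull sets of arbitrarily small measure\<close>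

lemma (in finite_measure) nonatomic_small_subset:
  assumes na: "nonatomic M" and E: "E \<in> sets M" "0 < measure M E" and e: "0 < e"
  obtains B where "B \<in> sets M" "B \<subseteq> E" "0 < measure M B" "measure M B < e"
proof -
  have halving: "\<exists>B\<in>sets M. B \<subseteq> E \<and> 0 < measure M B \<and> measure M B \<le> measure M E / 2 ^ n" for n
  proof (induction n)
    case 0
    then show ?case using E by auto
  next
    case (Suc n)
    then obtain B where B: "B \<in> sets M" "B \<subseteq> E" "0 < measure M B" "measure M B \<le> measure M E / 2 ^ n"
      by blast
    then obtain C where C: "C \<in> sets M" "C \<subseteq> B" "0 < emeasure M C" "emeasure M C < emeasure M B"
      using na unfolding nonatomic_def by (metis emeasure_eq_measure ennreal_less_zero_iff)
    then have C': "0 < measure M C" "measure M C < measure M B"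
      by (auto simp: emeasure_eq_measure ennreal_less_iff)
    have D: "measure M (B - C) = measure M B - measure M C"
      using B C by (simp add: finite_measure_Diff)
    \<comment> \<open>Both \<open>C\<close> and \<open>B - C\<close> are nonnull and their measures
      add up to that of \<open>B\<close>, so one of them has at most half of it.\<close>
    show ?case
    proof (cases "measure M C \<le> measure M B / 2")
      case True
      then show ?thesis using B C C' by (intro bexI[of _ C]) auto
    next
      case False
      then show ?thesis using B C C' D by (intro bexI[of _ "B - C"]) auto
    qed
  qed
  obtain n where "measure M E / e < 2 ^ n"
    using real_arch_pow[of 2 "measure M E / e"] by auto
  then have "measure M E / 2 ^ n < e"
    using e by (simp add: field_simps)
  then show thesis using halving[of n] that by force
qed

text \<open>Maximality in measure, rather than in inclusion, is within reach of a countable greedy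
  choice: step n comes within 1/(n+1) of the supremum of the measures still attainable, a supremum
  that is finite because the measure is.\<close>

lemma (in finite_measure) maximal_measure_under_incseq_Union:
  assumes G: "P G" and P_sets: "\<And>V. P V \<Longrightarrow> V \<in> sets M"
    and P_UN: "\<And>V. incseq V \<Longrightarrow> (\<And>n::nat. P (V n)) \<Longrightarrow> P (\<Union>n. V n)"
  obtains V where "P V" "G \<subseteq> V" "\<And>W. P W \<Longrightarrow> V \<subseteq> W \<Longrightarrow> measure M W \<le> measure M V"
proof -
  have greedy: "\<exists>Y. (P Y \<and> G \<subseteq> Y) \<and> V \<subseteq> Y \<and> (\<forall>W. P W \<longrightarrow> V \<subseteq> W \<longrightarrow> measure M W \<le> measure M Y + 1 / (real n + 1))"
    if V: "P V \<and> G \<subseteq> V" for V n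
  proof -
    define S where "S = measure M ` {W. P W \<and> V \<subseteq> W}"
    have bdd: "bdd_above S"
      unfolding S_def by (intro bdd_aboveI[of _ "measure M (space M)"]) (auto intro: bounded_measure)
    have "S \<noteq> {}" using V unfolding S_def by blast
    then obtain x where x: "x \<in> S" "Sup S - 1 / (real n + 1) < x"
      using less_cSup_iff[OF _ bdd, of "Sup S - 1 / (real n + 1)"] by auto
    then obtain Y where Y: "P Y" "V \<subseteq> Y" "x = measure M Y"
      unfolding S_def by blast
    have "measure M W \<le> measure M Y + 1 / (real n + 1)" if "P W" "V \<subseteq> W" for W
      using cSup_upper[OF _ bdd, of "measure M W"] that x Y unfolding S_def by force
    then show ?thesis using V Y by blast
  qed
  have "\<exists>V. \<forall>n. (P (V n) \<and> G \<subseteq> V n) \<and> V n \<subseteq> V (Suc n) \<and>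
      (\<forall>W. P W \<longrightarrow> V n \<subseteq> W \<longrightarrow> measure M W \<le> measure M (V (Suc n)) + 1 / (real n + 1))"
    by (rule dependent_nat_choice, use G in blast) (rule greedy)
  then obtain V where V: "\<And>n. P (V n) \<and> G \<subseteq> V n"
    and V_Suc: "\<And>n. V n \<subseteq> V (Suc n) \<and>
      (\<forall>W. P W \<longrightarrow> V n \<subseteq> W \<longrightarrow> measure M W \<le> measure M (V (Suc n)) + 1 / (real n + 1))"
    by blast
  have "incseq V" using V_Suc by (simp add: incseq_SucI)
  then have PU: "P (\<Union>n. V n)" using P_UN V by blast
  show thesis
  proof
    show "P (\<Union>n. V n)" by (fact PU)
    show "G \<subseteq> (\<Union>n. V n)" using V by blast
    fix W assume W: "P W" "(\<Union>n. V n) \<subseteq> W"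
    \<comment> \<open>A set \<open>W\<close> above the union lies above every \<open>V n\<close>, so
      it competed at every step of the greedy choice.\<close>
    have bound: "measure M W \<le> measure M (\<Union>n. V n) + 1 / (real n + 1)" for n
    proof -
      have "measure M W \<le> measure M (V (Suc n)) + 1 / (real n + 1)"
        using V_Suc W by blast
      also have "measure M (V (Suc n)) \<le> measure M (\<Union>n. V n)"
        using PU P_sets by (intro finite_measure_mono) auto
      finally show ?thesis by simp
    qed
    have "measure M W \<le> measure M (\<Union>n. V n) + d" if d: "d > 0" for d
    proof -
      obtain n where "1 / (real n + 1) < d"
        using nat_approx_posE[OF d] by (metis of_nat_Suc add.commute)
      then show ?thesis using bound[of n] by linarith
    qed
    then show "measure M W \<le> measure M (\<Union>n. V n)"
      by (rule field_le_epsilon)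
  qed
qed

lemma (in finite_measure) open_between_of_measure:
  assumes open_sets: "\<And>U. openin X U \<Longrightarrow> U \<in> sets M"
    and na: "nonatomic M"
    and approx: "\<And>B. B \<in> sets M \<Longrightarrow> approximable_by_open X M B"
    and G: "openin X G" and H: "openin X H" and "G \<subseteq> H"
    and c: "measure M G \<le> c" "c \<le> measure M H"
  obtains W where "openin X W" "G \<subseteq> W" "W \<subseteq> H" "measure M W = c"
proof -
  \<comment> \<open>The bound \<open>c\<close> is part of \<open>P\<close>, so the greedy choice
    cannot overshoot; continuity from below preserves it under increasing unions.\<close>
  define P where "P V \<longleftrightarrow> openin X V \<and> V \<subseteq> H \<and> measure M V \<le> c" for V
  have P_UN: "P (\<Union>n. V n)" if inc: "incseq V" and V: "\<And>n::nat. P (V n)" for V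
  proof -
    have "(\<lambda>n. measure M (V n)) \<longlonglongrightarrow> measure M (\<Union>n. V n)"
      using V inc open_sets unfolding P_def by (intro finite_Lim_measure_incseq) auto
    then have "measure M (\<Union>n. V n) \<le> c"
      by (rule LIMSEQ_le_const2) (use V in \<open>auto simp: P_def\<close>)
    then show ?thesis using V unfolding P_def by auto
  qed
  have P_sets: "V \<in> sets M" if "P V" for V using that open_sets unfolding P_def by blast
  have "P G" using G \<open>G \<subseteq> H\<close> c unfolding P_def by blast
  then obtain V where V: "P V" "G \<subseteq> V" and
    V_max: "\<And>W. P W \<Longrightarrow> V \<subseteq> W \<Longrightarrow> measure M W \<le> measure M V"
    using maximal_measure_under_incseq_Union[of P G, OF _ P_sets P_UN] by blast
  have Vs: "V \<in> sets M" "H \<in> sets M" "V \<subseteq> H" using V H open_sets unfolding P_def by auto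
  have "\<not> measure M V < c"
  proof
    assume less: "measure M V < c"
    then have pos: "0 < measure M (H - V)"
      using c Vs by (simp add: finite_measure_Diff)
    obtain B where B: "B \<in> sets M" "B \<subseteq> H - V" "0 < measure M B" "measure M B < c - measure M V"
      using nonatomic_small_subset[OF na _ pos, of "c - measure M V"] less Vs by auto
    \<comment> \<open>The first entry of the minimum makes \<open>U \<inter> H - V\<close> nonnull,
      since \<open>U\<close> cannot miss almost all of \<open>B\<close>. The second keeps the
      measure of \<open>V \<union> (U \<inter> H)\<close> below \<open>c\<close>. Cutting
      \<open>U\<close> down to \<open>H\<close> keeps the enlarged set open and inside
      \<open>H\<close>.\<close>
    define d where "d = min (measure M B) (c - measure M V - measure M B)"
    have "d > 0" using B unfolding d_def by simp
    then obtain U where U: "openin X U" "emeasure M (sym_diff B U) < ennreal d"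
      using approx[OF B(1)] unfolding approximable_by_open_def by blast
    have Us: "U \<in> sets M" using U open_sets by blast
    have sd: "measure M (sym_diff B U) < d"
      using U(2) \<open>d > 0\<close> by (simp add: emeasure_eq_measure ennreal_less_iff)
    have W: "measure M (V \<union> (U \<inter> H)) = measure M V + measure M (U \<inter> H - V)"
      using Us Vs by (subst finite_measure_Union'[OF Vs(1)]) auto
    have "measure M (U \<inter> H - V) \<le> measure M (B \<union> sym_diff B U)"
      using Us Vs B by (intro finite_measure_mono) auto
    also have "\<dots> \<le> measure M B + measure M (sym_diff B U)"
      using Us B by (intro measure_Un_le) auto
    finally have upper: "measure M (U \<inter> H - V) < c - measure M V"
      using sd unfolding d_def by linarith
    have "measure M B \<le> measure M ((U \<inter> H - V) \<union> sym_diff B U)"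
      using Us Vs B by (intro finite_measure_mono) auto
    also have "\<dots> \<le> measure M (U \<inter> H - V) + measure M (sym_diff B U)"
      using Us Vs B by (intro measure_Un_le) auto
    finally have lower: "0 < measure M (U \<inter> H - V)"
      using sd unfolding d_def by linarith
    have "P (V \<union> (U \<inter> H))"
      using V U H W upper unfolding P_def by auto
    then show False using V_max[of "V \<union> (U \<inter> H)"] W lower by auto
  qed
  then show thesis using that V unfolding P_def by force
qed

section \<open>Countable chains of open sets\<close>

lemma Union_mem_finite_chain:
  assumes "finite F" "F \<noteq> {}" "\<And>V W. V \<in> F \<Longrightarrow> W \<in> F \<Longrightarrow> V \<subseteq> W \<or> W \<subseteq> V"
  shows "\<Union>F \<in> F"
  using assms by (intro Union_in_chain) (auto simp: subset.chain_def)

lemma Inter_mem_finite_chain: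
  assumes "finite F" "F \<noteq> {}" "\<And>V W. V \<in> F \<Longrightarrow> W \<in> F \<Longrightarrow> V \<subseteq> W \<or> W \<subseteq> V"
  shows "\<Inter>F \<in> F"
  using assms by (intro Inter_in_chain) (auto simp: subset.chain_def)

text \<open>Finiteness gives the value \<open>c\<close> two neighbours in the chain, the largest
  member of smaller measure and the smallest member of larger measure. An open set placed between
  these two is comparable with every member.\<close>

lemma (in finite_measure) extend_finite_open_chain:
  assumes open_sets: "\<And>U. openin X U \<Longrightarrow> U \<in> sets M"
    and na: "nonatomic M"
    and approx: "\<And>B. B \<in> sets M \<Longrightarrow> approximable_by_open X M B"
    and F: "finite F" "\<And>V. V \<in> F \<Longrightarrow> openin X V" "\<And>V W. V \<in> F \<Longrightarrow> W \<in> F \<Longrightarrow> V \<subseteq> W \<or> W \<subseteq> V"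
    and c: "G \<in> F" "measure M G \<le> c" "H \<in> F" "c \<le> measure M H"
  obtains W where "openin X W" "measure M W = c" "\<And>V. V \<in> F \<Longrightarrow> V \<subseteq> W \<or> W \<subseteq> V"
proof (cases "\<exists>W\<in>F. measure M W = c")
  case True
  then show thesis using that F by blast
next
  case False
  define L where "L = {V \<in> F. measure M V < c}"
  define R where "R = {V \<in> F. c < measure M V}"
  have L: "\<Union>L \<in> L"
  proof (rule Union_mem_finite_chain)
    show "finite L" "L \<noteq> {}" using F(1) c(1,2) False unfolding L_def by force+
  qed (use F(3) in \<open>simp add: L_def\<close>)
  have R: "\<Inter>R \<in> R"
  proof (rule Inter_mem_finite_chain)
    show "finite R" "R \<noteq> {}" using F(1) c(3,4) False unfolding R_def by force+
  qed (use F(3) in \<open>simp add: R_def\<close>)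
  have LF: "\<Union>L \<in> F" "measure M (\<Union>L) < c" using L unfolding L_def by auto
  have RF: "\<Inter>R \<in> F" "c < measure M (\<Inter>R)" using R unfolding R_def by auto
  \<comment> \<open>Members of a chain with different measures are nested in the order of their
    measures.\<close>
  have "\<not> \<Inter>R \<subseteq> \<Union>L"
    using finite_measure_mono[of "\<Inter>R" "\<Union>L"] LF RF F open_sets by force
  then have LR: "\<Union>L \<subseteq> \<Inter>R" using F(3)[OF LF(1) RF(1)] by blast
  obtain W where W: "openin X W" "\<Union>L \<subseteq> W" "W \<subseteq> \<Inter>R" "measure M W = c"
    using open_between_of_measure[OF open_sets na approx F(2)[OF LF(1)] F(2)[OF RF(1)] LR
        less_imp_le[OF LF(2)] less_imp_le[OF RF(2)]] .
  have "V \<subseteq> W \<or> W \<subseteq> V" if "V \<in> F" for V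
  proof -
    have "V \<in> L \<or> V \<in> R" using that False unfolding L_def R_def by force
    then show ?thesis using W by blast
  qed
  then show thesis using that W by blast
qed

text \<open>The rational values are inserted one at a time, so that every stage is a finite chain
  and has neighbours for the next value.\<close>

lemma (in finite_measure) dense_open_chain:
  assumes open_sets: "\<And>U. openin X U \<Longrightarrow> U \<in> sets M"
    and na: "nonatomic M"
    and approx: "\<And>B. B \<in> sets M \<Longrightarrow> approximable_by_open X M B"
    and A: "openin X A" and top: "topspace X = space M"
  obtains C where "countable C" "{} \<in> C" "A \<in> C" "space M \<in> C"
    "\<forall>V\<in>C. openin X V" "\<forall>V\<in>C. \<forall>W\<in>C. V \<subseteq> W \<or> W \<subseteq> V"
    "\<rat> \<inter> {0..measure M (space M)} \<subseteq> measure M ` C"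
proof -
  define Q where "Q = \<rat> \<inter> {0..measure M (space M)}"
  have "0 \<in> Q" unfolding Q_def by simp
  have "countable Q" unfolding Q_def using countable_rat by (rule countable_subset[rotated]) auto
  then obtain q :: "nat \<Rightarrow> real" where q: "range q = Q"
    using \<open>0 \<in> Q\<close> by (metis empty_iff range_from_nat_into)
  define P where "P F \<longleftrightarrow> finite F \<and> {{}, A, space M} \<subseteq> F \<and> (\<forall>V\<in>F. openin X V) \<and>
    (\<forall>V\<in>F. \<forall>W\<in>F. V \<subseteq> W \<or> W \<subseteq> V)" for F
  have base: "P {{}, A, space M}"
    using A openin_subset[OF A] openin_topspace[of X] top unfolding P_def by auto
  have step: "\<exists>F'. P F' \<and> F \<subseteq> F' \<and> (\<exists>W\<in>F'. measure M W = q n)" if F: "P F" for F n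
  proof -
    have qn: "0 \<le> q n" "q n \<le> measure M (space M)" using q unfolding Q_def by auto
    obtain W where "openin X W" "measure M W = q n" "\<And>V. V \<in> F \<Longrightarrow> V \<subseteq> W \<or> W \<subseteq> V"
      using extend_finite_open_chain[OF open_sets na approx, of F "{}" "q n" "space M"] F qn
      unfolding P_def by auto
    then show ?thesis
      using F unfolding P_def by (intro exI[of _ "insert W F"]) auto
  qed
  have "\<exists>F. \<forall>n. P (F n) \<and> F n \<subseteq> F (Suc n) \<and> (\<exists>W\<in>F (Suc n). measure M W = q n)"
    by (rule dependent_nat_choice, use base in blast) (rule step)
  then obtain F where F: "\<And>n. P (F n)"
    and F_Suc: "\<And>n. F n \<subseteq> F (Suc n) \<and> (\<exists>W\<in>F (Suc n). measure M W = q n)"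
    by blast
  have inc: "incseq F" using F_Suc by (simp add: incseq_SucI)
  show thesis
  proof
    show "countable (\<Union>n. F n)" using F unfolding P_def by (auto intro: countable_finite)
    show "{} \<in> (\<Union>n. F n)" "A \<in> (\<Union>n. F n)" "space M \<in> (\<Union>n. F n)"
      using F[of 0] unfolding P_def by auto
    show "\<forall>V\<in>(\<Union>n. F n). openin X V" using F unfolding P_def by blast
    show "\<forall>V\<in>(\<Union>n. F n). \<forall>W\<in>(\<Union>n. F n). V \<subseteq> W \<or> W \<subseteq> V"
    proof (intro ballI)
      \<comment> \<open>Members that entered at different stages are both present at the later one,
        which is a chain.\<close>
      fix V W assume VW: "V \<in> (\<Union>n. F n)" "W \<in> (\<Union>n. F n)"
      obtain i j where "V \<in> F i" "W \<in> F j" using VW by blast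
      then have "V \<in> F (max i j)" "W \<in> F (max i j)"
        using incseqD[OF inc, of i "max i j"] incseqD[OF inc, of j "max i j"] by auto
      then show "V \<subseteq> W \<or> W \<subseteq> V" using F unfolding P_def by blast
    qed
    show "\<rat> \<inter> {0..measure M (space M)} \<subseteq> measure M ` (\<Union>n. F n)"
    proof
      fix x assume "x \<in> \<rat> \<inter> {0..measure M (space M)}"
      then obtain n where "x = q n" using q unfolding Q_def by blast
      moreover obtain W where "W \<in> F (Suc n)" "measure M W = q n" using F_Suc[of n] by blast
      ultimately show "x \<in> measure M ` (\<Union>n. F n)" by (metis UN_I UNIV_I image_eqI)
    qed
  qed
qed

text \<open>The union of the first members of an enumeration is again a member of the chain, so it
  obeys the bound \<open>s\<close>, which then passes to the limit by continuity from below.\<close>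

lemma (in finite_measure) measure_Union_countable_chain:
  assumes C: "countable C" "C \<noteq> {}" "C \<subseteq> sets M" "\<And>V W. V \<in> C \<Longrightarrow> W \<in> C \<Longrightarrow> V \<subseteq> W \<or> W \<subseteq> V"
    and s: "\<And>V. V \<in> C \<Longrightarrow> measure M V \<le> s"
  shows "measure M (\<Union>C) \<le> s"
proof -
  define V where "V n = \<Union>(from_nat_into C ` {..n})" for n :: nat
  have V: "V n \<in> C" for n
  proof -
    have sub: "from_nat_into C ` {..n} \<subseteq> C" using from_nat_into[OF C(2)] by blast
    then have "\<Union>(from_nat_into C ` {..n}) \<in> from_nat_into C ` {..n}"
      using C(4) by (intro Union_mem_finite_chain) blast+
    then show ?thesis using sub unfolding V_def by blast
  qed
  have "\<Union>C = \<Union>(range (from_nat_into C))" using C by (simp add: range_from_nat_into)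
  also have "\<dots> = (\<Union>n. V n)" unfolding V_def by auto
  finally have UC: "\<Union>C = (\<Union>n. V n)" .
  have "(\<lambda>n. measure M (V n)) \<longlonglongrightarrow> measure M (\<Union>n. V n)"
    using V C by (intro finite_Lim_measure_incseq) (auto simp: V_def incseq_def)
  then show ?thesis
    unfolding UC by (rule LIMSEQ_le_const2) (use V s in auto)
qed

section \<open>The segment built from a dense chain\<close>

theorem proposition4p2:
  fixes X :: "'a topology" and M :: "'a measure" and A :: "'a set"
  assumes "topspace X = space M"
    and "\<And>U. openin X U \<Longrightarrow> U \<in> sets M"
    and "finite_measure M"
    and "emeasure M (space M) > 0"
    and "nonatomic M"
    and "\<And>B. B \<in> sets M \<Longrightarrow> approximable_by_open X M B"
    and "openin X A"
    and "emeasure M A < \<infinity>"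
    and "emeasure M A = 0 \<Longrightarrow> A = {}"
    and "emeasure M A = emeasure M (space M) \<Longrightarrow> A = space M"
  shows "\<exists>u. O_segment X M u \<and> u (measure M A / measure M (space M)) = A"
proof -
  interpret finite_measure M by fact
  define m where "m = measure M (space M)"
  have m: "m > 0" using assms(4) unfolding m_def by (simp add: emeasure_eq_measure)
  have A0: "A = {}" if "measure M A = 0" using that assms(9) by (simp add: emeasure_eq_measure)
  have Am: "A = space M" if "measure M A = m"
    using that assms(10) by (simp add: emeasure_eq_measure m_def)
  obtain C where C: "countable C" "{} \<in> C" "A \<in> C" "space M \<in> C"
    and C_open: "\<forall>V\<in>C. openin X V"
    and C_chain: "\<forall>V\<in>C. \<forall>W\<in>C. V \<subseteq> W \<or> W \<subseteq> V"
    and C_dense: "\<rat> \<inter> {0..measure M (space M)} \<subseteq> measure M ` C"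
    using dense_open_chain[OF assms(2,5,6,7,1)] .
  have C_sets: "V \<in> sets M" if "V \<in> C" for V using that C_open assms(2) by blast
  have C_mono: "V \<subseteq> W" if "V \<in> C" "W \<in> C" "measure M V < measure M W" for V W
    using C_chain finite_measure_mono[of W V] C_sets that by force
  \<comment> \<open>The strict inequality puts \<open>B (measure M V)\<close> inside
    \<open>V\<close> for each \<open>V\<close> in the chain, while \<open>V\<close> lies in every
    later \<open>B s\<close>.\<close>
  define B where "B s = \<Union>{W \<in> C. measure M W < s}" for s
  have B_open: "openin X (B s)" for s unfolding B_def using C_open by (intro openin_Union) auto
  have B_mono: "B s \<subseteq> B t" if "s \<le> t" for s t unfolding B_def using that by auto
  have B_subset: "B (measure M V) \<subseteq> V" if "V \<in> C" for V
    unfolding B_def using C_mono that by blast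
  have B_superset: "V \<subseteq> B s" if "V \<in> C" "measure M V < s" for V s
    unfolding B_def using that by blast
  have B_measure: "measure M (B s) = s" if s: "0 < s" "s \<le> m" for s
  proof (rule antisym)
    show "measure M (B s) \<le> s"
      unfolding B_def
    proof (rule measure_Union_countable_chain)
      show "countable {W \<in> C. measure M W < s}" using C(1) by (rule countable_subset[rotated]) auto
      show "{W \<in> C. measure M W < s} \<noteq> {}" using C(2) s by auto
    qed (use C_sets C_chain in auto)
    \<comment> \<open>Below \<open>s\<close> there are rational values arbitrarily close to it, each
      the measure of a member of the chain that lies in \<open>B s\<close>.\<close>
    show "s \<le> measure M (B s)"
    proof (rule dense_le_bounded[OF s(1)])
      fix w assume w: "0 < w" "w < s"
      obtain q where q: "q \<in> \<rat>" "w < q" "q < s" using Rats_dense_in_real w by blast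
      then have "q \<in> \<rat> \<inter> {0..measure M (space M)}" using w s unfolding m_def by auto
      then obtain W where W: "W \<in> C" "measure M W = q" using C_dense by blast
      have "measure M W \<le> measure M (B s)"
        using B_superset[of W s] W q B_open assms(2) by (intro finite_measure_mono) auto
      then show "w \<le> measure M (B s)" using W q by simp
    qed
  qed
  \<comment> \<open>\<open>B\<close> may miss null parts of \<open>A\<close> and of the whole space
    at their own values, so these two sets are put in by hand. The exclusion of nonempty null
    \<open>A\<close> and of proper \<open>A\<close> of full measure lets \<open>v\<close> still take
    the values \<open>{}\<close> at 0 and \<open>space M\<close> at \<open>m\<close>.\<close>
  define v where "v s = (if s = measure M A then A else if s = m then space M else B s)" for s
  have v_open: "openin X (v s)" for s
    unfolding v_def using B_open assms(7) openin_topspace[of X] assms(1) by auto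
  have B0: "B 0 = {}" unfolding B_def by (simp add: not_less)
  have v_measure: "measure M (v s) = s" if "0 \<le> s" "s \<le> m" for s
    using that B_measure[of s] B0 unfolding v_def by (cases "s = 0") (auto simp: m_def)
  have v_mono: "v s \<subseteq> v t" if st: "s < t" "t \<le> m" for s t
  proof (cases "t = m")
    case True
    then have "v t = space M" unfolding v_def using Am by auto
    then show ?thesis using v_open[of s] openin_subset assms(1) by metis
  next
    case False
    \<comment> \<open>Since \<open>A\<close> belongs to the chain, \<open>B s\<close> lies in
      \<open>A\<close> for s up to the measure of \<open>A\<close>, and \<open>A\<close> lies in
      \<open>B t\<close> for larger t; hence the insertion keeps \<open>v\<close> monotone.\<close>
    then show ?thesis
      using st B_mono[of s t] B_superset[OF C(3), of t] B_subset[OF C(3)] unfolding v_def by auto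
  qed
  \<comment> \<open>\<open>v\<close> is indexed by measure in [0, m]; the factor \<open>m\<close>
    rescales the parameter to [0, 1].\<close>
  have "O_segment X M (\<lambda>t. v (t * m))"
    unfolding O_segment_def
  proof (intro conjI ballI impI)
    show "v (0 * m) = {}" using A0 B0 m unfolding v_def by auto
    show "v (1 * m) = topspace X" using Am assms(1) unfolding v_def by auto
    show "openin X (v (t * m))" for t by (rule v_open)
    show "v (s * m) \<subseteq> v (t * m)" if "s \<in> {0..1}" "t \<in> {0..1}" "s < t" for s t
      using that m by (intro v_mono) (auto simp: mult_le_cancel_right1)
    show "measure M (v (t * m)) = t * measure M (topspace X)" if "t \<in> {0..1}" for t
      using that m v_measure[of "t * m"] assms(1) by (auto simp: mult_le_cancel_right1 m_def)
  qed
  moreover have "v (measure M A / measure M (space M) * m) = A"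
    using m unfolding v_def m_def by auto
  ultimately show ?thesis by blast
qed

end
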